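(* Let $R$ be a finite commutative ring with identity such that $gr(\Gamma_E(R)) = \infty$. (i) If $R$ is a reduced ring, then $Mdim(\Gamma_E(R)) = 1$. (ii) If $R$ is isomorphic to $\mathbb{Z}_4$, $\mathbb{Z}_9$, or $\mathbb{Z}_2[x]/(x^2)$, then $Mdim(\Gamma_E(R)) = 0$.
   Context: A ring is reduced if it has no nonzero nilpotent elements. $gr(G)$ denotes the girth of a graph $G$ (length of a shortest cycle), with $gr(G)=\infty$ if $G$ has no cycle. For a commutative ring $R$ with identity $1\neq 0$, $Z(R)$ denotes its set of zero-divisors (including $0$). For $x\in R$ let $[x]=\{y\in R : \mathrm{ann}(x)=\mathrm{ann}(y)\}$. The compressed zero-divisor graph $\Gamma_E(R)$ is the simple graph whose vertices are the classes $[x]$ with $x\in Z(R)\setminus\{0\}$, distinct classes $[x],[y]$ being adjacent iff $xy=0$. For a connected graph $G$, a vertex $v$ and $W\subseteq V(G)$, the multiset representation of $v$ with respect to $W$ is the multiset $\{d(v,w): w\in W\}$ of distances (with multiplicities). $W$ is an m-resolving set if distinct vertices have distinct multiset representations. $Mdim(G)$ is the minimum cardinality of an m-resolving set, with $Mdim(G)=\infty$ if none exists; by convention $Mdim$ of a single-vertex graph is $0$.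
   Formalization: Part (i) additionally assumes that Γ_E(R) has at least one vertex (R is not a field); for a finite field the graph is empty, its girth is infinite, and the empty set is m-resolving, so Mdim would be 0 rather than 1. *)

theory Defs
  imports
    "HOL-Library.Extended_Nat"
    "HOL-Library.Multiset"
    "HOL-Algebra.Polynomial_Divisibility"
    "HOL-Number_Theory.Residues"
    "Graph_Theory.Pair_Digraph"
    "Graph_Theory.Shortest_Path"
begin

text \<open>Simple graphs are symmetric loop-free digraphs (locale \<^locale>\<open>pair_bidirected_digraph\<close>).\<close>

text \<open>
  In a symmetric digraph the closed walk $u, v, u$ along a single edge counts as a
  \<^const>\<open>pre_digraph.cycle\<close>. The cycles of the underlying simple graph are exactly those of
  length at least 3. The infimum of the empty set of \<^typ>\<open>enat\<close> is \<^term>\<open>\<infinity> :: enat\<close>.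
\<close>
definition girth :: "'v pair_pre_digraph \<Rightarrow> enat" where
  "girth G = (INF p \<in> {p. pre_digraph.cycle (with_proj G) p \<and> 3 \<le> length p}. enat (length p))"

definition graph_dist :: "'v pair_pre_digraph \<Rightarrow> 'v \<Rightarrow> 'v \<Rightarrow> ereal" where
  "graph_dist G u v = wf_digraph.\<mu> (with_proj G) (\<lambda>_. 1) u v"

definition multiset_rep :: "'v pair_pre_digraph \<Rightarrow> 'v set \<Rightarrow> 'v \<Rightarrow> ereal multiset" where
  "multiset_rep G W v = image_mset (graph_dist G v) (mset_set W)"

definition m_resolving :: "'v pair_pre_digraph \<Rightarrow> 'v set \<Rightarrow> bool" where
  "m_resolving G W \<longleftrightarrow> finite W \<and> W \<subseteq> pverts G \<and> inj_on (multiset_rep G W) (pverts G)"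

text \<open>
  For a graph with a single vertex the empty set is m-resolving, so the value is 0 without
  a separate clause.
\<close>
definition Mdim :: "'v pair_pre_digraph \<Rightarrow> enat" where
  "Mdim G = (INF W \<in> {W. m_resolving G W}. enat (card W))"

definition zero_divisors :: "('a, 'm) ring_scheme \<Rightarrow> 'a set" where
  "zero_divisors R =
     {x \<in> carrier R. \<exists>y \<in> carrier R. y \<noteq> \<zero>\<^bsub>R\<^esub> \<and> x \<otimes>\<^bsub>R\<^esub> y = \<zero>\<^bsub>R\<^esub>}"

definition reduced_ring :: "('a, 'm) ring_scheme \<Rightarrow> bool" where
  "reduced_ring R \<longleftrightarrow>
     (\<forall>x \<in> carrier R. (\<exists>n::nat. x [^]\<^bsub>R\<^esub> n = \<zero>\<^bsub>R\<^esub>) \<longrightarrow> x = \<zero>\<^bsub>R\<^esub>)"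

definition ann :: "('a, 'm) ring_scheme \<Rightarrow> 'a \<Rightarrow> 'a set" where
  "ann R x = {r \<in> carrier R. r \<otimes>\<^bsub>R\<^esub> x = \<zero>\<^bsub>R\<^esub>}"

definition ann_class :: "('a, 'm) ring_scheme \<Rightarrow> 'a \<Rightarrow> 'a set" where
  "ann_class R x = {y \<in> carrier R. ann R x = ann R y}"

definition Gamma_E :: "('a, 'm) ring_scheme \<Rightarrow> 'a set pair_pre_digraph" where
  "Gamma_E R =
     \<lparr> pverts = ann_class R ` (zero_divisors R - {\<zero>\<^bsub>R\<^esub>}),
       parcs = {(ann_class R x, ann_class R y) | x y.
          x \<in> zero_divisors R - {\<zero>\<^bsub>R\<^esub>} \<and> y \<in> zero_divisors R - {\<zero>\<^bsub>R\<^esub>} \<and>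
          ann_class R x \<noteq> ann_class R y \<and> x \<otimes>\<^bsub>R\<^esub> y = \<zero>\<^bsub>R\<^esub>} \<rparr>"

definition Z2_dual_numbers :: "int list set ring" where
  "Z2_dual_numbers =
     (let P = poly_ring (residue_ring 2)
      in P Quot (PIdl\<^bsub>P\<^esub> (X\<^bsub>residue_ring 2\<^esub> [^]\<^bsub>P\<^esub> (2::nat))))"

lemma Gamma_E_adjacent_iff:
  fixes R (structure)
  assumes "cring R"
    and x: "x \<in> zero_divisors R - {\<zero>\<^bsub>R\<^esub>}" and y: "y \<in> zero_divisors R - {\<zero>\<^bsub>R\<^esub>}"
  shows "(ann_class R x, ann_class R y) \<in> parcs (Gamma_E R) \<longleftrightarrow>
           ann_class R x \<noteq> ann_class R y \<and> x \<otimes>\<^bsub>R\<^esub> y = \<zero>\<^bsub>R\<^esub>"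
proof -
  interpret cring R by fact
  have carr: "z \<in> carrier R" if "z \<in> zero_divisors R - {\<zero>\<^bsub>R\<^esub>}" for z
    using that by (auto simp: zero_divisors_def)
  have cls: "ann R x = ann R x'"
    if "ann_class R x' = ann_class R x" "x \<in> carrier R" "x' \<in> carrier R" for x x'
    using that by (auto simp: ann_class_def)
  have "x \<otimes> y = \<zero>"
    if x': "x' \<in> zero_divisors R - {\<zero>}" "ann_class R x' = ann_class R x"
      and y': "y' \<in> zero_divisors R - {\<zero>}" "ann_class R y' = ann_class R y"
      and 0: "x' \<otimes> y' = \<zero>" for x' y'
  proof -
    have "x' \<in> ann R y"
      using 0 cls[OF y'(2)] carr x' y' y by (auto simp: ann_def)
    then have "y \<in> ann R x'"
      using carr x' y by (auto simp: ann_def m_comm)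
    then have "y \<in> ann R x"
      using cls[OF x'(2)] carr x x' by auto
    then show ?thesis using carr x y by (auto simp: ann_def m_comm)
  qed
  then have "(ann_class R x, ann_class R y) \<in> parcs (Gamma_E R) \<Longrightarrow>
      ann_class R x \<noteq> ann_class R y \<and> x \<otimes> y = \<zero>"
    unfolding Gamma_E_def pair_pre_digraph.simps mem_Collect_eq prod.inject by metis
  moreover have "ann_class R x \<noteq> ann_class R y \<and> x \<otimes> y = \<zero> \<Longrightarrow>
      (ann_class R x, ann_class R y) \<in> parcs (Gamma_E R)"
    unfolding Gamma_E_def pair_pre_digraph.simps mem_Collect_eq prod.inject using x y by blast
  ultimately show ?thesis by blast
qed

lemma Gamma_E_simple:
  fixes R (structure)
  assumes "cring R"
  shows "pair_bidirected_digraph (Gamma_E R)"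
proof -
  interpret cring R by fact
  show ?thesis
  proof
    show "symmetric (with_proj (Gamma_E R))"
      unfolding symmetric_def
    proof (rule symI)
      fix a b assume "(a, b) \<in> arcs_ends (with_proj (Gamma_E R))"
      then obtain x y where "a = ann_class R x" "b = ann_class R y"
          "x \<in> zero_divisors R - {\<zero>}" "y \<in> zero_divisors R - {\<zero>}" "a \<noteq> b" "x \<otimes> y = \<zero>"
        by (auto simp: Gamma_E_def)
      moreover from this have "y \<otimes> x = \<zero>"
        by (auto simp: zero_divisors_def m_comm)
      ultimately show "(b, a) \<in> arcs_ends (with_proj (Gamma_E R))"
        by (auto simp: Gamma_E_def)
    qed
  qed (auto simp: Gamma_E_def)
qed

end

theory Submission
  imports Defs
begin

text \<open>
  In a reduced ring, elements \<open>x, y \<noteq> 0\<close> with \<open>xy = 0\<close> have different annihilators, so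
  an acyclic compressed graph forbids three nonzero elements with pairwise zero products.
  Given \<open>ab = 0\<close> and \<open>cd = 0\<close>, the products \<open>ca, cb, da, db\<close> annihilate each other pairwise, so at
  least two of them vanish; this forces \<open>c\<close> to annihilate \<open>a\<close> or \<open>b\<close>, and then to have the same
  annihilator as the other one. Hence there are exactly two vertices, and either one
  of them resolves the graph.

  In the three local rings, which are quotients of a domain by the square of a prime,
  the product of any two zero divisors vanishes, so there is only one class.
\<close>

section \<open>Girth, distance and multiset dimension of small graphs\<close>

lemma cycle_triangle:
  assumes "pair_wf_digraph G" "(u, v) \<in> parcs G" "(v, w) \<in> parcs G" "(w, u) \<in> parcs G"
    and "u \<noteq> v" "v \<noteq> w" "w \<noteq> u"
  shows "pre_digraph.cycle (with_proj G) [(u, v), (v, w), (w, u)]"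
proof -
  interpret pair_wf_digraph G by fact
  have "u \<in> pverts G" using in_arcsD1 assms(2) by blast
  then show ?thesis
    unfolding cycle_def awalk_def using assms(2-) by auto
qed

lemma girth_infinite_no_triangle:
  assumes "pair_wf_digraph G" "girth G = \<infinity>"
    and "(u, v) \<in> parcs G" "(v, w) \<in> parcs G" "(w, u) \<in> parcs G"
    and "u \<noteq> v" "v \<noteq> w" "w \<noteq> u"
  shows False
proof -
  have "girth G \<le> enat (length [(u, v), (v, w), (w, u)])"
    unfolding girth_def using cycle_triangle[OF assms(1,3-)] by (intro INF_lower) simp
  then show False using assms(2) by simp
qed

lemma graph_dist_eq_0_iff:
  assumes "pair_wf_digraph G" "u \<in> pverts G"
  shows "graph_dist G u v = 0 \<longleftrightarrow> u = v"
proof -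
  interpret pair_wf_digraph G by fact
  have len: "awalk_cost (\<lambda>_. 1) p = real (length p)" for p :: "('a \<times> 'a) list"
    by (induct p) auto
  show ?thesis
  proof
    assume "u = v"
    then have "awalk u [] v" using assms(2) by (simp add: awalk_Nil_iff)
    then have "\<mu> (\<lambda>_. 1) u v \<le> 0"
      using min_cost_le_walk_cost[of u "[]" v "\<lambda>_. 1"] by (simp add: zero_ereal_def)
    moreover have "0 \<le> \<mu> (\<lambda>_. 1) u v"
      unfolding \<mu>_def len by (intro INF_greatest) simp
    ultimately show "graph_dist G u v = 0" unfolding graph_dist_def by simp
  next
    assume 0: "graph_dist G u v = 0"
    show "u = v"
    proof (rule ccontr)
      assume "u \<noteq> v"
      \<comment> \<open>A walk without arcs ends where it starts. If no walk reaches
        \<open>v\<close>, the infimum over walks is infinite, so no connectivity is assumed.\<close>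
      have "1 \<le> length p" if "awalk u p v" for p
        using that \<open>u \<noteq> v\<close> by (cases p) (auto simp: awalk_Nil_iff)
      then have "1 \<le> \<mu> (\<lambda>_. 1) u v"
        unfolding \<mu>_def len by (intro INF_greatest) (auto simp: one_ereal_def)
      with 0 show False unfolding graph_dist_def by simp
    qed
  qed
qed

text \<open>No edge between \<open>u\<close> and \<open>v\<close> is required: distance 0 occurs
  only from a vertex to itself, which already separates their representations over
  \<open>{u}\<close>.\<close>

lemma Mdim_two_vertices:
  assumes "pair_wf_digraph G" "pverts G = {u, v}" "u \<noteq> v"
  shows "Mdim G = 1"
proof (rule antisym)
  have "graph_dist G u u = 0" "graph_dist G v u \<noteq> 0"
    using graph_dist_eq_0_iff[OF assms(1)] assms(2,3) by auto
  then have "m_resolving G {u}"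
    using assms(2) by (auto simp: m_resolving_def multiset_rep_def)
  then have "Mdim G \<le> enat (card {u})"
    unfolding Mdim_def by (intro INF_lower) simp
  then show "Mdim G \<le> 1" by (simp add: one_enat_def)
  \<comment> \<open>The empty set gives both vertices the empty multiset.\<close>
  have "\<not> m_resolving G {}"
    using assms(2,3) by (auto simp: m_resolving_def multiset_rep_def)
  \<comment> \<open>Finiteness of \<open>W\<close> is part of \<open>m_resolving\<close>; it matters
    because \<open>card\<close> is 0 on infinite sets.\<close>
  then have "1 \<le> card W" if "m_resolving G W" for W
    using that by (cases "W = {}") (auto simp: m_resolving_def Suc_le_eq card_gt_0_iff)
  then show "1 \<le> Mdim G"
    unfolding Mdim_def by (intro INF_greatest) (auto simp: one_enat_def)
qed

lemma Mdim_eq_0: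
  assumes "\<And>u v. u \<in> pverts G \<Longrightarrow> v \<in> pverts G \<Longrightarrow> u = v"
  shows "Mdim G = 0"
proof -
  have "m_resolving G {}"
    using assms by (auto simp: m_resolving_def inj_on_def)
  then have "Mdim G \<le> enat (card ({} :: 'a set))"
    unfolding Mdim_def by (intro INF_lower) simp
  then show ?thesis by (simp flip: zero_enat_def)
qed

section \<open>Reduced rings with an acyclic compressed graph\<close>

lemma reduced_ring_square_zero:
  fixes R (structure)
  assumes "cring R" "reduced_ring R" "x \<in> carrier R" "x \<otimes> x = \<zero>"
  shows "x = \<zero>"
proof -
  interpret cring R by fact
  have "x [^] (2::nat) = \<zero>" using assms(3,4) by (simp add: numeral_2_eq_2)
  then show ?thesis using assms(2,3) unfolding reduced_ring_def by blast
qed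

text \<open>Since \<open>x\<close> annihilates \<open>y\<close>, equal annihilators would make
  \<open>x\<close> annihilate itself, a nonzero element of square zero.\<close>

lemma reduced_ann_class_neq:
  fixes R (structure)
  assumes "cring R" "reduced_ring R" "x \<in> carrier R" "y \<in> carrier R" "x \<noteq> \<zero>" "x \<otimes> y = \<zero>"
  shows "ann_class R x \<noteq> ann_class R y"
proof
  assume "ann_class R x = ann_class R y"
  then have "ann R x = ann R y" using assms(3) by (auto simp: ann_class_def)
  moreover have "x \<in> ann R y" using assms by (simp add: ann_def)
  ultimately have "x \<otimes> x = \<zero>" by (auto simp: ann_def)
  then show False using reduced_ring_square_zero[OF assms(1-3)] assms(5) by simp
qed

text \<open>Three nonzero elements of this kind would have distinct, pairwise adjacent classes,
  hence form a triangle and force the girth to be at most 3.\<close>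

lemma reduced_acyclic_no_triple:
  fixes R (structure)
  assumes "cring R" "reduced_ring R" "girth (Gamma_E R) = \<infinity>"
    and carr: "x \<in> carrier R" "y \<in> carrier R" "z \<in> carrier R"
    and zero: "x \<otimes> y = \<zero>" "y \<otimes> z = \<zero>" "z \<otimes> x = \<zero>"
  shows "x = \<zero> \<or> y = \<zero> \<or> z = \<zero>"
proof (rule ccontr)
  assume "\<not> ?thesis"
  then have nz: "x \<noteq> \<zero>" "y \<noteq> \<zero>" "z \<noteq> \<zero>" by auto
  interpret G: pair_bidirected_digraph "Gamma_E R" using Gamma_E_simple assms(1) .
  have zd: "x \<in> zero_divisors R - {\<zero>}" "y \<in> zero_divisors R - {\<zero>}" "z \<in> zero_divisors R - {\<zero>}"
    using carr zero nz by (auto simp: zero_divisors_def)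
  note neq = reduced_ann_class_neq[OF assms(1,2)]
  have ne: "ann_class R x \<noteq> ann_class R y" "ann_class R y \<noteq> ann_class R z"
    "ann_class R z \<noteq> ann_class R x"
    using neq carr zero nz by auto
  note adj = Gamma_E_adjacent_iff[OF assms(1)]
  show False
    using girth_infinite_no_triangle[OF G.pair_wf_digraph_axioms assms(3), of "ann_class R x" "ann_class R y" "ann_class R z"]
      adj zd ne zero by auto
qed

lemma reduced_acyclic_ann_eq:
  fixes R (structure)
  assumes "cring R" "reduced_ring R" "girth (Gamma_E R) = \<infinity>"
    and "a \<in> carrier R" "b \<in> carrier R" "c \<in> carrier R" "a \<noteq> \<zero>" "b \<noteq> \<zero>" "c \<noteq> \<zero>"
    and "a \<otimes> b = \<zero>" "c \<otimes> a = \<zero>"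
  shows "ann R c = ann R b"
proof -
  interpret cring R by fact
  note triple = reduced_acyclic_no_triple[OF assms(1-3)]
  \<comment> \<open>If \<open>r\<close> kills \<open>x\<close>, then \<open>r \<otimes> y\<close>,
    \<open>a\<close> and \<open>x\<close> annihilate each other pairwise; as \<open>a\<close> and
    \<open>x\<close> are nonzero, \<open>r \<otimes> y\<close> vanishes. Both inclusions follow by
    taking \<open>c\<close> and \<open>b\<close> in either order.\<close>
  have "ann R x \<subseteq> ann R y"
    if "x \<in> carrier R" "y \<in> carrier R" "x \<noteq> \<zero>" "x \<otimes> a = \<zero>" "y \<otimes> a = \<zero>" for x y
  proof
    fix r assume "r \<in> ann R x"
    then have r: "r \<in> carrier R" "r \<otimes> x = \<zero>" by (auto simp: ann_def)
    have "(r \<otimes> y) \<otimes> a = \<zero>" using r that assms(4) by (simp add: m_assoc)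
    moreover have "x \<otimes> (r \<otimes> y) = (r \<otimes> x) \<otimes> y"
      using r(1) that(1,2) by (simp add: m_assoc m_lcomm)
    then have "x \<otimes> (r \<otimes> y) = \<zero>" using r that by simp
    moreover have "a \<otimes> x = \<zero>" using that assms(4) by (simp add: m_comm)
    ultimately have "r \<otimes> y = \<zero>" using triple[of "r \<otimes> y" a x] r that assms(4,7) by simp
    then show "r \<in> ann R y" using r by (simp add: ann_def)
  qed
  moreover have "b \<otimes> a = \<zero>" using assms by (simp add: m_comm)
  ultimately show ?thesis using assms by (meson subset_antisym)
qed

lemma reduced_acyclic_annihilates:
  fixes R (structure)
  assumes "cring R" "reduced_ring R" "girth (Gamma_E R) = \<infinity>"
    and carr: "a \<in> carrier R" "b \<in> carrier R" "c \<in> carrier R" "d \<in> carrier R"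
    and nz: "a \<noteq> \<zero>" "b \<noteq> \<zero>" "c \<noteq> \<zero>" "d \<noteq> \<zero>"
    and ab: "a \<otimes> b = \<zero>" and cd: "c \<otimes> d = \<zero>"
  shows "c \<otimes> a = \<zero> \<or> c \<otimes> b = \<zero>"
proof (rule ccontr)
  interpret cring R by fact
  note triple = reduced_acyclic_no_triple[OF assms(1-3)]
  assume "\<not> ?thesis"
  then have ne: "c \<otimes> a \<noteq> \<zero>" "c \<otimes> b \<noteq> \<zero>" by auto
  \<comment> \<open>Regrouping exposes a factor \<open>a \<otimes> b\<close> or
    \<open>c \<otimes> d\<close>, up to order, in each product below.\<close>
  have swap: "(x \<otimes> y) \<otimes> (z \<otimes> w) = (x \<otimes> z) \<otimes> (y \<otimes> w)"
    if "x \<in> carrier R" "y \<in> carrier R" "z \<in> carrier R" "w \<in> carrier R" for x y z w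
    using that by algebra
  have ba: "b \<otimes> a = \<zero>" and dc: "d \<otimes> c = \<zero>" using ab cd carr by (simp_all add: m_comm)
  have "d \<otimes> a = \<zero>"
    using triple[of "c \<otimes> a" "c \<otimes> b" "d \<otimes> a"] carr ne ab ba cd dc
      swap[of c a c b] swap[of c b d a] swap[of d a c a] by simp
  moreover have "d \<otimes> b = \<zero>"
    using triple[of "c \<otimes> a" "c \<otimes> b" "d \<otimes> b"] carr ne ab ba cd dc
      swap[of c a c b] swap[of c b d b] swap[of d b c a] by simp
  \<comment> \<open>Now \<open>d\<close> kills both \<open>a\<close> and \<open>b\<close>, so
    \<open>a\<close>, \<open>b\<close>, \<open>d\<close> form a forbidden triple.\<close>
  ultimately show False using triple[of a b d] carr nz ab by (simp add: m_comm)
qed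

lemma reduced_acyclic_Mdim:
  fixes R (structure)
  assumes "cring R" "reduced_ring R" "girth (Gamma_E R) = \<infinity>" "pverts (Gamma_E R) \<noteq> {}"
  shows "Mdim (Gamma_E R) = 1"
proof -
  interpret cring R by fact
  interpret G: pair_bidirected_digraph "Gamma_E R" using Gamma_E_simple assms(1) .
  obtain a where "a \<in> zero_divisors R - {\<zero>}"
    using assms(4) by (auto simp: Gamma_E_def)
  then obtain b where a: "a \<in> carrier R" "a \<noteq> \<zero>" and b: "b \<in> carrier R" "b \<noteq> \<zero>"
    and ab: "a \<otimes> b = \<zero>"
    by (auto simp: zero_divisors_def)
  then have ba: "b \<otimes> a = \<zero>" by (simp add: m_comm)
  have "ann_class R c \<in> {ann_class R a, ann_class R b}" if c0: "c \<in> zero_divisors R - {\<zero>}" for c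
  proof -
    obtain d where c: "c \<in> carrier R" "c \<noteq> \<zero>" and d: "d \<in> carrier R" "d \<noteq> \<zero>" "c \<otimes> d = \<zero>"
      using c0 by (auto simp: zero_divisors_def)
    \<comment> \<open>The match is crosswise: if \<open>c\<close> kills \<open>a\<close> it has the
      annihilator of \<open>b\<close>, and conversely.\<close>
    have "ann R c = ann R a \<or> ann R c = ann R b"
      using reduced_acyclic_annihilates[OF assms(1-3) a(1) b(1) c(1) d(1) a(2) b(2) c(2) d(2) ab d(3)]
        reduced_acyclic_ann_eq[OF assms(1-3) a(1) b(1) c(1) a(2) b(2) c(2) ab]
        reduced_acyclic_ann_eq[OF assms(1-3) b(1) a(1) c(1) b(2) a(2) c(2) ba] by blast
    then show ?thesis by (auto simp: ann_class_def)
  qed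
  moreover have "a \<in> zero_divisors R - {\<zero>}" "b \<in> zero_divisors R - {\<zero>}"
    using a b ab ba by (auto simp: zero_divisors_def)
  ultimately have "pverts (Gamma_E R) = {ann_class R a, ann_class R b}"
    by (auto simp: Gamma_E_def)
  then show ?thesis
    using Mdim_two_vertices[OF G.pair_wf_digraph_axioms]
      reduced_ann_class_neq[OF assms(1,2) a(1) b(1) a(2) ab] by blast
qed

section \<open>Rings in which products of zero divisors vanish\<close>

lemma Mdim_Gamma_E_zero_products:
  fixes R (structure)
  assumes "\<And>x y. x \<in> zero_divisors R \<Longrightarrow> y \<in> zero_divisors R \<Longrightarrow> x \<otimes> y = \<zero>"
    and "cring R"
  shows "Mdim (Gamma_E R) = 0"
proof (rule Mdim_eq_0)
  interpret cring R by fact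
  have "ann R x = zero_divisors R" if "x \<in> zero_divisors R - {\<zero>}" for x
  proof
    have "x \<in> carrier R" "x \<noteq> \<zero>" using that by (auto simp: zero_divisors_def)
    \<comment> \<open>The nonzero \<open>x\<close> is itself the witness that each element of its
      annihilator is a zero divisor.\<close>
    then show "ann R x \<subseteq> zero_divisors R" by (auto simp: ann_def zero_divisors_def)
    have "r \<in> carrier R \<and> r \<otimes> x = \<zero>" if "r \<in> zero_divisors R" for r
      using assms(1)[OF that] \<open>x \<in> zero_divisors R - {\<zero>}\<close> that by (simp add: zero_divisors_def)
    then show "zero_divisors R \<subseteq> ann R x" by (auto simp: ann_def)
  qed
  then have "ann_class R x = ann_class R y"
    if "x \<in> zero_divisors R - {\<zero>}" "y \<in> zero_divisors R - {\<zero>}" for x y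
    using that unfolding ann_class_def by simp
  then show "u = v" if "u \<in> pverts (Gamma_E R)" "v \<in> pverts (Gamma_E R)" for u v
    using that unfolding Gamma_E_def pair_pre_digraph.simps by blast
qed

text \<open>Reduces the claim to the three model rings: an injective homomorphism sends zero
  divisors to zero divisors and reflects vanishing of products.\<close>

lemma ring_iso_zero_divisor_products:
  fixes R (structure) and S (structure)
  assumes "ring R" "ring S" "R \<simeq> S"
    and S: "\<And>x y. x \<in> zero_divisors S \<Longrightarrow> y \<in> zero_divisors S \<Longrightarrow> x \<otimes>\<^bsub>S\<^esub> y = \<zero>\<^bsub>S\<^esub>"
    and x: "x \<in> zero_divisors R" and y: "y \<in> zero_divisors R"
  shows "x \<otimes> y = \<zero>"
proof -
  interpret ring R by fact
  obtain h where h: "h \<in> ring_iso R S" using assms(3) by (auto simp: is_ring_iso_def)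
  have hom: "h \<in> ring_hom R S" and inj: "inj_on h (carrier R)"
    using h by (auto simp: ring_iso_def bij_betw_def)
  note h0 = ring_hom_zero[OF hom assms(1,2)]
  have zd: "h z \<in> zero_divisors S" if z: "z \<in> zero_divisors R" for z
  proof -
    obtain w where w: "z \<in> carrier R" "w \<in> carrier R" "w \<noteq> \<zero>" "z \<otimes> w = \<zero>"
      using z by (auto simp: zero_divisors_def)
    then have "h w \<noteq> \<zero>\<^bsub>S\<^esub>" using inj h0 by (metis inj_onD zero_closed)
    moreover have "h z \<otimes>\<^bsub>S\<^esub> h w = \<zero>\<^bsub>S\<^esub>" using w h0 ring_hom_mult[OF hom] by metis
    ultimately show ?thesis
      using w ring_hom_closed[OF hom] by (auto simp: zero_divisors_def)
  qed
  have carr: "x \<in> carrier R" "y \<in> carrier R" using x y by (auto simp: zero_divisors_def)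
  have "h (x \<otimes> y) = h \<zero>"
    using S[OF zd[OF x] zd[OF y]] ring_hom_mult[OF hom carr] h0 by simp
  then show ?thesis using inj carr by (meson inj_onD m_closed zero_closed)
qed

lemma residue_ring_prime_square_zero_divisor_products:
  assumes p: "Factorial_Ring.prime (p::int)"
    and x: "x \<in> zero_divisors (residue_ring (p\<^sup>2))" and y: "y \<in> zero_divisors (residue_ring (p\<^sup>2))"
  shows "x \<otimes>\<^bsub>residue_ring (p\<^sup>2)\<^esub> y = \<zero>\<^bsub>residue_ring (p\<^sup>2)\<^esub>"
proof -
  have dvd: "p dvd z" if z: "z \<in> zero_divisors (residue_ring (p\<^sup>2))" for z
  proof (rule ccontr)
    assume "\<not> p dvd z"
    \<comment> \<open>Coprimality would force the square of \<open>p\<close> to divide the witness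
      \<open>w\<close>, which lies strictly between 0 and that square.\<close>
    then have cop: "coprime (p\<^sup>2) z"
      using p by (simp add: prime_imp_coprime)
    obtain w where w: "0 \<le> w" "w < p\<^sup>2" "w \<noteq> 0" "p\<^sup>2 dvd z * w"
      using z by (auto simp: zero_divisors_def residue_ring_def)
    then have "p\<^sup>2 dvd w" using cop by (simp add: coprime_dvd_mult_right_iff)
    with w show False using zdvd_imp_le[of "p\<^sup>2" w] by simp
  qed
  have "p\<^sup>2 dvd x * y"
    unfolding power2_eq_square using dvd x y by (intro mult_dvd_mono)
  then show ?thesis by (simp add: residue_ring_def)
qed

text \<open>Every zero divisor of the quotient has a representative divisible by \<open>p\<close>,
  so a product of two has a representative divisible by the square of \<open>p\<close>.\<close>

lemma (in domain) Quot_prime_square_zero_divisor_products: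
  assumes p: "p \<in> carrier R" "ring_prime p" and I: "I = PIdl (p [^] (2::nat))"
    and A: "A \<in> zero_divisors (R Quot I)" and B: "B \<in> zero_divisors (R Quot I)"
  shows "A \<otimes>\<^bsub>R Quot I\<^esub> B = \<zero>\<^bsub>R Quot I\<^esub>"
proof -
  have p2: "p [^] (2::nat) = p \<otimes> p" using p by (simp add: numeral_2_eq_2)
  interpret I: ideal I R unfolding I using cgenideal_ideal p by simp
  have mem: "x \<in> I \<longleftrightarrow> (\<exists>r \<in> carrier R. x = r \<otimes> (p \<otimes> p))" for x
    unfolding I p2 cgenideal_def by auto
  \<comment> \<open>The zero of the quotient is the coset \<open>I\<close> itself.\<close>
  have coset: "I +> x = I \<longleftrightarrow> x \<in> I" if "x \<in> carrier R" for x
    using that I.a_rcos_const I.a_rcos_self by blast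
  have prime: "p divides x \<or> p divides y"
    if "x \<in> carrier R" "y \<in> carrier R" "p divides (x \<otimes> y)" for x y
    using that p ring_primeE(3)[OF p] by (auto elim: primeE)
  have rep: "\<exists>f \<in> carrier R. Z = I +> f \<and> p divides f" if "Z \<in> zero_divisors (R Quot I)" for Z
  proof -
    obtain W where "Z \<in> carrier (R Quot I)" "W \<in> carrier (R Quot I)" and W: "W \<noteq> I"
      "Z \<otimes>\<^bsub>R Quot I\<^esub> W = I"
      using \<open>Z \<in> zero_divisors (R Quot I)\<close> by (auto simp: zero_divisors_def FactRing_def)
    then obtain f g where f: "f \<in> carrier R" "Z = I +> f" and g: "g \<in> carrier R" "W = I +> g"
      by (auto simp: FactRing_simps)
    have "I +> (f \<otimes> g) = I" using W f g by (simp add: FactRing_def I.rcoset_mult_add)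
    then obtain r where r: "r \<in> carrier R" "f \<otimes> g = r \<otimes> (p \<otimes> p)"
      using coset mem f g by auto
    have "p divides f"
    proof (rule ccontr)
      assume nf: "\<not> p divides f"
      \<comment> \<open>Primality is used twice: if \<open>p\<close> does not divide
        \<open>f\<close>, it divides \<open>g\<close>, and after cancelling one \<open>p\<close>
        also the cofactor \<open>k\<close>. Then \<open>g\<close> lies in \<open>I\<close>, so
        \<open>W\<close> would be zero.\<close>
      have "f \<otimes> g = p \<otimes> (r \<otimes> p)" using r p by (simp add: m_lcomm m_comm)
      then have "p divides (f \<otimes> g)" using r p by (intro dividesI) auto
      then obtain k where k: "k \<in> carrier R" "g = p \<otimes> k"
        using prime[of f g] f g nf by (auto elim!: dividesE)
      have "p \<otimes> (f \<otimes> k) = p \<otimes> (p \<otimes> r)" using r k p f by (simp add: m_ac)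
      then have "f \<otimes> k = p \<otimes> r"
        using m_lcancel[of p "f \<otimes> k" "p \<otimes> r"] ring_primeE(1)[OF p] p f k r by simp
      then have "p divides (f \<otimes> k)" using r by (intro dividesI) auto
      then obtain l where l: "l \<in> carrier R" "k = p \<otimes> l"
        using prime[of f k] f k nf by (auto elim!: dividesE)
      have "g = l \<otimes> (p \<otimes> p)" using k l p by (simp add: m_ac)
      then have "g \<in> I" using mem l by blast
      then show False using coset g W by simp
    qed
    then show ?thesis using f by blast
  qed
  obtain f g where f: "f \<in> carrier R" "A = I +> f" "p divides f"
    and g: "g \<in> carrier R" "B = I +> g" "p divides g"
    using rep A B by blast
  obtain k l where k: "k \<in> carrier R" "f = p \<otimes> k" and l: "l \<in> carrier R" "g = p \<otimes> l"
    using f(3) g(3) by (auto elim!: dividesE)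
  have "f \<otimes> g = (k \<otimes> l) \<otimes> (p \<otimes> p)" using k l p by (simp add: m_ac)
  then have "f \<otimes> g \<in> I" using mem k l by blast
  then show ?thesis using f g coset by (simp add: FactRing_def I.rcoset_mult_add)
qed

text \<open>\<open>X\<close> has degree one, hence is irreducible, and over a field irreducible
  polynomials are prime.\<close>

lemma (in field) var_prime:
  "ring_prime\<^bsub>poly_ring R\<^esub> X"
proof -
  have X: "X \<in> carrier (poly_ring R)" using var_closed(1)[OF carrier_is_subring] .
  then have "pirreducible (carrier R) X"
    using degree_one_imp_pirreducible[OF carrier_is_subfield] by (simp add: var_def)
  then show ?thesis using pprime_iff_pirreducible[OF carrier_is_subfield X] by simp
qed

lemma Z2_dual_numbers_props:
  shows ring_Z2_dual_numbers: "ring Z2_dual_numbers"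
    and Z2_dual_numbers_zero_divisor_products:
      "x \<in> zero_divisors Z2_dual_numbers \<Longrightarrow> y \<in> zero_divisors Z2_dual_numbers \<Longrightarrow>
        x \<otimes>\<^bsub>Z2_dual_numbers\<^esub> y = \<zero>\<^bsub>Z2_dual_numbers\<^esub>"
proof -
  \<comment> \<open>The locale takes a natural number as modulus, hence \<open>int 2\<close>; the
    next interpretation restates the field with the integer 2.\<close>
  interpret residues_prime 2 "residue_ring (int 2)" by unfold_locales simp_all
  interpret F: field "residue_ring 2" using is_field by simp
  let ?P = "poly_ring (residue_ring 2)"
  interpret P: domain ?P using F.univ_poly_is_domain[OF F.carrier_is_subring] .
  have X: "X\<^bsub>residue_ring 2\<^esub> \<in> carrier ?P" using F.var_closed(1)[OF F.carrier_is_subring] .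
  show "ring Z2_dual_numbers"
    unfolding Z2_dual_numbers_def Let_def
    using P.cgenideal_ideal X by (intro ideal.quotient_is_ring) simp
  show "x \<otimes>\<^bsub>Z2_dual_numbers\<^esub> y = \<zero>\<^bsub>Z2_dual_numbers\<^esub>"
    if "x \<in> zero_divisors Z2_dual_numbers" "y \<in> zero_divisors Z2_dual_numbers"
    using that P.Quot_prime_square_zero_divisor_products[OF X F.var_prime refl]
    unfolding Z2_dual_numbers_def Let_def by blast
qed

text \<open>A finite field is reduced but has no nonzero zero divisors; its graph has no vertices
  and \<open>Mdim\<close> 0. The first claim therefore asks for a nonempty vertex set.\<close>

theorem theorem4p1:
  fixes R :: "('a, 'm) ring_scheme" (structure)
  assumes "cring R" and "\<one> \<noteq> \<zero>" and "finite (carrier R)"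
    and "girth (Gamma_E R) = \<infinity>"
  shows "(reduced_ring R \<and> pverts (Gamma_E R) \<noteq> {} \<longrightarrow> Mdim (Gamma_E R) = 1) \<and>
    (R \<simeq> residue_ring 4 \<or> R \<simeq> residue_ring 9 \<or> R \<simeq> Z2_dual_numbers \<longrightarrow> Mdim (Gamma_E R) = 0)"
proof (intro conjI impI)
  show "Mdim (Gamma_E R) = 1" if "reduced_ring R \<and> pverts (Gamma_E R) \<noteq> {}"
    using reduced_acyclic_Mdim that assms by blast
  interpret cring R by fact
  assume "R \<simeq> residue_ring 4 \<or> R \<simeq> residue_ring 9 \<or> R \<simeq> Z2_dual_numbers"
  then have "x \<otimes> y = \<zero>" if "x \<in> zero_divisors R" "y \<in> zero_divisors R" for x y
  proof (elim disjE)
    assume iso: "R \<simeq> residue_ring 4"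
    have "ring (residue_ring 4)" using residues.cring[of 4] by (simp add: residues_def cring.axioms)
    then show ?thesis
      using ring_iso_zero_divisor_products[OF ring_axioms _ iso _ that]
        residue_ring_prime_square_zero_divisor_products[of 2] by simp
  next
    assume iso: "R \<simeq> residue_ring 9"
    have "ring (residue_ring 9)" using residues.cring[of 9] by (simp add: residues_def cring.axioms)
    then show ?thesis
      using ring_iso_zero_divisor_products[OF ring_axioms _ iso _ that]
        residue_ring_prime_square_zero_divisor_products[of 3] by simp
  next
    assume iso: "R \<simeq> Z2_dual_numbers"
    show ?thesis
      using ring_iso_zero_divisor_products[OF ring_axioms ring_Z2_dual_numbers iso _ that]
        Z2_dual_numbers_zero_divisor_products by blast
  qed
  then show "Mdim (Gamma_E R) = 0" using Mdim_Gamma_E_zero_products assms(1) by blast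
qed

end
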